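(* Let $C$ be a commutative Noetherian ring containing an uncountable field $K$ of characteristic zero, let $n,m\ge1$, and let $R=C[X_1,\dots,X_n,Y_1,\dots,Y_m]$ with its standard $\mathbb{Z}^2$-grading. Let $M=\bigoplus_{(u,v)\in\mathbb{Z}^2}M_{(u,v)}$ be a bigraded generalized Eulerian $A_{n,m}(C)$-module which is countably generated as a bigraded $R$-module. Let $a_1,a_2,b_1,b_2$ be non-negative integers and let $$\mathcal{S}=\{(u,v)\in\mathbb{Z}^2 \mid -b_1\le u\le a_1 \text{ or } -b_2\le v\le a_2\}.$$ If $M_{(u,v)}=0$ for every $(u,v)\notin\mathcal{S}$, then $M=0$.
   Context: $A_{n,m}(C)=R\langle \partial_1,\dots,\partial_n,\delta_1,\dots,\delta_m\rangle$ is the Weyl algebra over $C$, with $\partial_i=\partial/\partial X_i$, $\delta_j=\partial/\partial Y_j$. Both $R$ and $A_{n,m}(C)$ are $\mathbb{Z}^2$-graded by $\operatorname{bideg} c=(0,0)$ for $c\in C$, $\operatorname{bideg} X_i=(1,0)$, $\operatorname{bideg} Y_j=(0,1)$, $\operatorname{bideg}\partial_i=(-1,0)$, $\operatorname{bideg}\delta_j=(0,-1)$. Put $\mathcal{E}^X_n=\sum_{i=1}^n X_i\partial_i$ and $\mathcal{E}^Y_m=\sum_{j=1}^m Y_j\delta_j$. A bigraded (left) $A_{n,m}(C)$-module $E$ is generalized Eulerian if for each bihomogeneous $e\in E$ with $\operatorname{bideg} e=(u,v)$ there is an integer $a>0$ with $(\mathcal{E}^X_n-u)^a e=0$ and $(\mathcal{E}^Y_m-v)^a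 e=0$. *)

theory Defs
  imports
    "HOL-Library.Poly_Mapping"
    "HOL-Library.Product_Plus"
    "HOL-Library.Countable_Set"
    "HOL-Algebra.Algebraic_Closure_Type"
begin

section \<open>The polynomial ring in two sets of variables\<close>

text \<open>
  The coefficient ring \<open>C\<close> is the type \<open>'c\<close>; the variables \<open>X\<^sub>1, \<dots>, X\<^sub>n\<close> and \<open>Y\<^sub>1, \<dots>, Y\<^sub>m\<close> are
  indexed by finite types \<open>'n\<close> and \<open>'m\<close>. Types are nonempty, so \<open>n, m \<ge> 1\<close>. A monomial is a map
  from variables to exponents, \<open>Inl i\<close> standing for \<open>X\<^sub>i\<close> and \<open>Inr j\<close> for \<open>Y\<^sub>j\<close>.
\<close>

type_synonym ('c, 'n, 'm) bipoly = "(('n + 'm) \<Rightarrow>\<^sub>0 nat) \<Rightarrow>\<^sub>0 'c"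

type_synonym ('c, 'n, 'm) bipoly_op = "('c, 'n, 'm) bipoly \<Rightarrow> ('c, 'n, 'm) bipoly"

definition const_bipoly :: "'c::comm_ring_1 \<Rightarrow> ('c, 'n, 'm) bipoly" where
  "const_bipoly c = Poly_Mapping.single 0 c"

definition bivar :: "'n + 'm \<Rightarrow> ('c::comm_ring_1, 'n, 'm) bipoly" where
  "bivar z = Poly_Mapping.single (Poly_Mapping.single z 1) 1"

abbreviation var_X :: "'n \<Rightarrow> ('c::comm_ring_1, 'n, 'm) bipoly" where
  "var_X i \<equiv> bivar (Inl i)"

abbreviation var_Y :: "'m \<Rightarrow> ('c::comm_ring_1, 'n, 'm) bipoly" where
  "var_Y j \<equiv> bivar (Inr j)"

text \<open>
  Term-by-term formal derivative. If \<open>z\<close> does not occur in \<open>\<mu>\<close>, the truncated subtraction leaves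
  \<open>\<mu>\<close> unchanged, but then the coefficient is \<open>0\<close>.
\<close>

definition partial_deriv :: "'n + 'm \<Rightarrow> ('c::comm_ring_1, 'n, 'm) bipoly_op" where
  "partial_deriv z f =
     (\<Sum>\<mu>\<in>Poly_Mapping.keys f.
        Poly_Mapping.single (\<mu> - Poly_Mapping.single z 1)
          (of_nat (Poly_Mapping.lookup \<mu> z) * Poly_Mapping.lookup f \<mu>))"

abbreviation partial_X :: "'n \<Rightarrow> ('c::comm_ring_1, 'n, 'm) bipoly_op" where
  "partial_X i \<equiv> partial_deriv (Inl i)"

abbreviation partial_Y :: "'m \<Rightarrow> ('c::comm_ring_1, 'n, 'm) bipoly_op" where
  "partial_Y j \<equiv> partial_deriv (Inr j)"


section \<open>The Weyl algebra\<close>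

text \<open>
  \<open>R\<langle>\<partial>\<^sub>1, \<dots>, \<partial>\<^sub>n, \<delta>\<^sub>1, \<dots>, \<delta>\<^sub>m\<rangle>\<close> as the ring of operators on \<open>R\<close> generated by the multiplications by
  elements of \<open>R\<close> and by the partial derivatives. The ring operations are pointwise addition and
  composition; negatives are obtained by composing with the multiplication by \<open>-1\<close>.
\<close>

inductive_set weyl_algebra :: "('c::comm_ring_1, 'n, 'm) bipoly_op set" where
  mult: "(\<lambda>f. r * f) \<in> weyl_algebra"
| deriv_X: "partial_X i \<in> weyl_algebra"
| deriv_Y: "partial_Y j \<in> weyl_algebra"
| add: "P \<in> weyl_algebra \<Longrightarrow> Q \<in> weyl_algebra \<Longrightarrow> (\<lambda>f. P f + Q f) \<in> weyl_algebra"
| comp: "P \<in> weyl_algebra \<Longrightarrow> Q \<in> weyl_algebra \<Longrightarrow> P \<circ> Q \<in> weyl_algebra"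

text \<open>
  \<open>weyl_bihom P (p, q)\<close> says that \<open>P\<close> lies in the bihomogeneous component of degree \<open>(p, q)\<close> of the
  Weyl algebra: it is a sum of words of that bidegree in the elements of \<open>C\<close>, the variables and the
  partial derivatives. The zero operator has every degree: compose a word with the constant \<open>0\<close>.
\<close>

inductive weyl_bihom :: "('c::comm_ring_1, 'n, 'm) bipoly_op \<Rightarrow> int \<times> int \<Rightarrow> bool" where
  const: "weyl_bihom (\<lambda>f. const_bipoly c * f) (0, 0)"
| var_X: "weyl_bihom (\<lambda>f. var_X i * f) (1, 0)"
| var_Y: "weyl_bihom (\<lambda>f. var_Y j * f) (0, 1)"
| deriv_X: "weyl_bihom (partial_X i) (-1, 0)"
| deriv_Y: "weyl_bihom (partial_Y j) (0, -1)"
| add: "weyl_bihom P d \<Longrightarrow> weyl_bihom Q d \<Longrightarrow> weyl_bihom (\<lambda>f. P f + Q f) d"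
| comp: "weyl_bihom P d \<Longrightarrow> weyl_bihom Q e \<Longrightarrow> weyl_bihom (P \<circ> Q) (d + e)"

definition euler_X :: "('c::comm_ring_1, 'n::finite, 'm) bipoly_op" where
  "euler_X f = (\<Sum>i\<in>UNIV. var_X i * partial_X i f)"

definition euler_Y :: "('c::comm_ring_1, 'n, 'm::finite) bipoly_op" where
  "euler_Y f = (\<Sum>j\<in>UNIV. var_Y j * partial_Y j f)"


section \<open>Bigraded modules over the Weyl algebra\<close>

text \<open>The values of \<open>act\<close> outside \<open>weyl_algebra\<close> are irrelevant.\<close>

locale weyl_module =
  fixes act :: "('c::comm_ring_1, 'n::finite, 'm::finite) bipoly_op \<Rightarrow> 'a::ab_group_add \<Rightarrow> 'a"
  assumes act_add_right: "P \<in> weyl_algebra \<Longrightarrow> act P (x + y) = act P x + act P y"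
    and act_add_left:
      "P \<in> weyl_algebra \<Longrightarrow> Q \<in> weyl_algebra \<Longrightarrow> act (\<lambda>f. P f + Q f) x = act P x + act Q x"
    and act_comp: "P \<in> weyl_algebra \<Longrightarrow> Q \<in> weyl_algebra \<Longrightarrow> act (P \<circ> Q) x = act P (act Q x)"
    and act_id: "act id x = x"

locale bigraded_weyl_module = weyl_module act
  for act :: "('c::comm_ring_1, 'n::finite, 'm::finite) bipoly_op \<Rightarrow> 'a::ab_group_add \<Rightarrow> 'a" +
  fixes M :: "int \<times> int \<Rightarrow> 'a set"
  assumes zero_mem: "0 \<in> M d"
    and add_mem: "x \<in> M d \<Longrightarrow> y \<in> M d \<Longrightarrow> x + y \<in> M d"
    and uminus_mem: "x \<in> M d \<Longrightarrow> - x \<in> M d"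
    and direct_sum:
      "\<exists>!g. (\<forall>d. g d \<in> M d) \<and> finite {d. g d \<noteq> 0} \<and> x = (\<Sum>d\<in>{d. g d \<noteq> 0}. g d)"
    and act_mem: "weyl_bihom P d \<Longrightarrow> x \<in> M e \<Longrightarrow> act P x \<in> M (d + e)"

locale generalized_eulerian_module = bigraded_weyl_module act M
  for act :: "('c::comm_ring_1, 'n::finite, 'm::finite) bipoly_op \<Rightarrow> 'a::ab_group_add \<Rightarrow> 'a"
    and M :: "int \<times> int \<Rightarrow> 'a set" +
  assumes eulerian:
    "e \<in> M (u, v) \<Longrightarrow>
       \<exists>a>0. act ((\<lambda>f. euler_X f - of_int u * f) ^^ a) e = 0 \<and>
             act ((\<lambda>f. euler_Y f - of_int v * f) ^^ a) e = 0"

definition countably_generated_bigraded ::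
    "(('c::comm_ring_1, 'n, 'm) bipoly_op \<Rightarrow> 'a::ab_group_add \<Rightarrow> 'a) \<Rightarrow> (int \<times> int \<Rightarrow> 'a set) \<Rightarrow> bool"
  where
  "countably_generated_bigraded act M \<longleftrightarrow>
     (\<exists>G. countable G \<and> G \<subseteq> (\<Union>d. M d) \<and>
          Modules.module.span (\<lambda>r. act (\<lambda>f. r * f)) G = UNIV)"

end

theory Submission
  imports Defs
begin

text \<open>
  If additive maps \<open>D\<close> and \<open>U\<close> satisfy \<open>[D, U] = 1\<close>, then \<open>D f = 0\<close> gives \<open>D (U\<^sup>l f) = l U\<^sup>l\<^sup>-\<^sup>1 f\<close>, so on a
  torsion-free group no nonzero element is killed by powers of both maps. On a row of the
  bigrading with only finitely many nonzero components, degree reasons make \<open>X\<^sub>1\<close> and \<open>\<partial>\<^sub>1\<close> locally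
  nilpotent, so the row vanishes; likewise for the columns, with \<open>Y\<^sub>1\<close> and \<open>\<delta>\<^sub>1\<close>. The rows outside
  the horizontal strip are supported in the vertical strip, hence vanish. Then every column is
  supported in the horizontal strip and vanishes as well.
\<close>

text \<open>Coefficientwise, the derivative is visibly additive; the defining sum ranges over keys
  that change with \<open>f\<close>.\<close>

lemma lookup_partial_deriv:
  "Poly_Mapping.lookup (partial_deriv z f) \<nu> =
     of_nat (Poly_Mapping.lookup \<nu> z + 1) * Poly_Mapping.lookup f (\<nu> + Poly_Mapping.single z 1)"
proof -
  let ?e = "Poly_Mapping.single z (1::nat)"
  let ?\<mu> = "\<nu> + ?e"
  have term_eq: "Poly_Mapping.lookup (Poly_Mapping.single (\<mu> - ?e)
          (of_nat (Poly_Mapping.lookup \<mu> z) * Poly_Mapping.lookup f \<mu>)) \<nu> =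
        (if \<mu> = ?\<mu> then of_nat (Poly_Mapping.lookup \<nu> z + 1) * Poly_Mapping.lookup f ?\<mu> else 0)"
    for \<mu>
  \<comment> \<open>If \<open>z\<close> is absent from \<open>\<mu>\<close>, truncated subtraction
    may still yield \<open>\<nu>\<close>, but with coefficient 0. On the remaining monomials,
    subtracting \<open>?e\<close> is injective.\<close>
  proof (cases "Poly_Mapping.lookup \<mu> z = 0")
    case True
    then have "\<mu> \<noteq> ?\<mu>" by (auto simp: lookup_add)
    then show ?thesis using True by simp
  next
    case False
    then have "\<mu> - ?e + ?e = \<mu>"
      by (intro poly_mapping_eqI) (auto simp: lookup_add lookup_minus lookup_single when_def)
    then have "\<mu> - ?e = \<nu> \<longleftrightarrow> \<mu> = ?\<mu>" by auto
    then show ?thesis by (auto simp: lookup_single when_def lookup_add)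
  qed
  show ?thesis
    unfolding partial_deriv_def lookup_sum term_eq by (simp add: in_keys_iff)
qed

lemma partial_deriv_add: "partial_deriv z (f + g) = partial_deriv z f + partial_deriv z g"
  by (intro poly_mapping_eqI) (simp add: lookup_partial_deriv lookup_add algebra_simps)

lemma partial_deriv_single:
  "partial_deriv z (Poly_Mapping.single \<mu> c) =
     Poly_Mapping.single (\<mu> - Poly_Mapping.single z 1) (of_nat (Poly_Mapping.lookup \<mu> z) * c)"
  by (cases "c = 0") (auto simp: partial_deriv_def)

lemma partial_deriv_bivar_mult:
  "partial_deriv z (bivar z * f) = bivar z * partial_deriv z f + f"
proof (induction f rule: update_induct)
  case const
  show ?case by (simp add: partial_deriv_def)
next
  case (update f \<mu> c)
  let ?e = "Poly_Mapping.single z (1::nat)" and ?m = "Poly_Mapping.single \<mu> c"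
  \<comment> \<open>For \<open>z\<close>-exponent k > 0 the monomial case reads k + 1 = k + 1; for k
    = 0 the derivative of \<open>?m\<close> vanishes and only \<open>?m\<close> remains.\<close>
  have "?e + (\<mu> - ?e) = \<mu>" if "Poly_Mapping.lookup \<mu> z \<noteq> 0"
    using that by (intro poly_mapping_eqI) (auto simp: lookup_add lookup_minus lookup_single when_def)
  then have monomial: "partial_deriv z (bivar z * ?m) = bivar z * partial_deriv z ?m + ?m"
    by (cases "Poly_Mapping.lookup \<mu> z = 0")
      (auto simp: bivar_def mult_single partial_deriv_single lookup_add distrib_right single_add)
  have "Poly_Mapping.update \<mu> c f = ?m + f"
    using update.hyps
    by (intro poly_mapping_eqI)
      (auto simp: lookup_add lookup_update lookup_single when_def in_keys_iff)
  with monomial update.IH show ?case by (simp add: distrib_left partial_deriv_add algebra_simps)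
qed

text \<open>The kernel argument applies to the last nonzero iterate of \<open>D\<close> on
  \<open>x\<close>, hence the condition on \<open>U\<close> along the whole \<open>D\<close>-orbit.
  Integer multiples are written as sums because \<open>'a\<close> is a bare abelian group.\<close>

lemma locally_nilpotent_weyl_pair:
  fixes D U :: "'a::ab_group_add \<Rightarrow> 'a"
  assumes D: "additive D" and U: "additive U"
    and comm: "\<And>x. D (U x) = U (D x) + x"
    and torsion_free: "\<And>(l::nat) x::'a. (\<Sum>i<l. x) = 0 \<Longrightarrow> l = 0 \<or> x = 0"
    and "(D ^^ k) x = 0" and "\<And>j. \<exists>l. (U ^^ l) ((D ^^ j) x) = 0"
  shows "x = 0"
proof -
  interpret D: additive D by (rule D)
  interpret U: additive U by (rule U)
  have kernel: "f = 0" if "D f = 0" "(U ^^ l) f = 0" for f l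
    using that(2)
  proof (induction l)
    case (Suc l)
    have "D ((U ^^ Suc l) f) = (\<Sum>i<Suc l. (U ^^ l) f)" for l
    proof (induction l)
      case 0
      show ?case by (simp add: comm that U.zero)
    next
      case (Suc l)
      have "D ((U ^^ Suc (Suc l)) f) = U (D ((U ^^ Suc l) f)) + (U ^^ Suc l) f"
        by (simp add: comm)
      \<comment> \<open>Additivity of \<open>U\<close> moves it inside the \<open>Suc l\<close>
        equal summands; the commutator supplies one more.\<close>
      also have "U (D ((U ^^ Suc l) f)) = (\<Sum>i<Suc l. (U ^^ Suc l) f)"
        by (subst Suc.IH) (simp only: U.sum funpow.simps o_apply)
      finally show ?case by (simp only: sum.lessThan_Suc)
    qed
    with Suc.prems have "(\<Sum>i<Suc l. (U ^^ l) f) = 0"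
      by (metis D.zero)
    then show ?case using torsion_free Suc.IH by blast
  qed simp
  from \<open>(D ^^ k) x = 0\<close> show ?thesis
  proof (induction k)
    case (Suc k)
    obtain l where "(U ^^ l) ((D ^^ k) x) = 0" using assms(6) by blast
    then have "(D ^^ k) x = 0" using kernel Suc.prems by simp
    then show ?case by (rule Suc.IH)
  qed simp
qed

lemma partial_deriv_mem: "partial_deriv z \<in> weyl_algebra"
  by (cases z) (auto intro: weyl_algebra.intros)

lemma id_mem: "id \<in> weyl_algebra"
proof -
  have "(\<lambda>f. 1 * f) \<in> weyl_algebra" by (rule weyl_algebra.mult)
  then show ?thesis by (simp add: id_def)
qed

context weyl_module
begin

lemma additive_act: "P \<in> weyl_algebra \<Longrightarrow> additive (act P)"
  by (simp add: additive_def act_add_right)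

lemma act_zero_right: "P \<in> weyl_algebra \<Longrightarrow> act P 0 = 0"
  by (rule additive.zero[OF additive_act])

lemma act_of_nat: "act (\<lambda>f. of_nat l * f) x = (\<Sum>i<l. x)"
proof (induction l)
  case 0
  \<comment> \<open>The zero operator is its own double, so its value y satisfies y = y + y.\<close>
  have "act (\<lambda>f. 0 * f + 0 * f) x = act (\<lambda>f. 0 * f) x + act (\<lambda>f. 0 * f) x"
    by (intro act_add_left weyl_algebra.mult)
  then show ?case by simp
next
  case (Suc l)
  have "act (\<lambda>f. of_nat l * f + 1 * f) x = act (\<lambda>f. of_nat l * f) x + act (\<lambda>f. 1 * f) x"
    by (intro act_add_left weyl_algebra.mult)
  moreover have "act (\<lambda>f. 1 * f) x = x"
    using act_id by (simp add: id_def)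
  ultimately show ?case
    by (simp add: Suc.IH distrib_right add.commute del: sum_constant)
qed

text \<open>An inverse of \<open>l\<close> in the coefficient ring also acts on the module and
  undoes adding up \<open>l\<close> copies.\<close>

lemma torsion_free:
  fixes x :: 'a
  assumes "\<And>l. l \<noteq> 0 \<Longrightarrow> (of_nat l :: 'c) dvd 1" and "(\<Sum>i<(l::nat). x) = 0"
  shows "l = 0 \<or> x = 0"
proof (cases "l = 0")
  case False
  then obtain c :: 'c where c: "1 = of_nat l * c" using assms(1) by (auto simp: dvd_def)
  have "const_bipoly c * of_nat l = (1 :: ('c, 'n, 'm) bipoly)"
    by (simp add: const_bipoly_def mult_single c mult.commute flip: single_of_nat single_one)
  then have "(\<lambda>f :: ('c, 'n, 'm) bipoly. const_bipoly c * f) \<circ> (\<lambda>f. of_nat l * f) = id"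
    by (auto simp: fun_eq_iff simp flip: mult.assoc)
  then have "x = act (\<lambda>f. const_bipoly c * f) (act (\<lambda>f. of_nat l * f) x)"
    by (metis act_comp act_id weyl_algebra.mult)
  then show ?thesis using assms(2)
    by (simp add: act_of_nat act_zero_right weyl_algebra.mult del: sum_constant)
qed simp

lemma act_partial_deriv_bivar:
  "act (partial_deriv z) (act (\<lambda>f. bivar z * f) x) =
     act (\<lambda>f. bivar z * f) (act (partial_deriv z) x) + x"
proof -
  have "act (partial_deriv z \<circ> (\<lambda>f. bivar z * f)) x =
      act (\<lambda>f. ((\<lambda>f. bivar z * f) \<circ> partial_deriv z) f + id f) x"
    by (simp add: comp_def partial_deriv_bivar_mult)
  also have "\<dots> = act ((\<lambda>f. bivar z * f) \<circ> partial_deriv z) x + act id x"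
    by (intro act_add_left weyl_algebra.comp weyl_algebra.mult partial_deriv_mem id_mem)
  finally show ?thesis
    by (simp add: act_comp act_id weyl_algebra.mult partial_deriv_mem)
qed

end

context bigraded_weyl_module
begin

lemma funpow_act_mem:
  assumes "weyl_bihom P (p, q)" and "x \<in> M (u, v)"
  shows "(act P ^^ k) x \<in> M (u + int k * p, v + int k * q)"
proof (induction k)
  case (Suc k)
  from act_mem[OF assms(1) this] show ?case by (simp add: algebra_simps)
qed (use assms in simp)

text \<open>Stated for a general direction \<open>(p, q)\<close>, so that rows and columns are both
  instances.\<close>

lemma line_vanishes:
  fixes z :: "'n + 'm"
  assumes units: "\<And>l. l \<noteq> 0 \<Longrightarrow> (of_nat l :: 'c) dvd 1"
    and var: "weyl_bihom (\<lambda>f :: ('c, 'n, 'm) bipoly. bivar z * f) (p, q)"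
    and deriv: "weyl_bihom (partial_deriv z :: ('c, 'n, 'm) bipoly_op) (- p, - q)"
    and zero: "\<And>k. k < - int b \<or> int a < k \<Longrightarrow> M (u + k * p, v + k * q) = {0}"
    and x: "x \<in> M (u, v)"
  shows "x = 0"
proof (rule locally_nilpotent_weyl_pair)
  let ?D = "act (partial_deriv z)" and ?X = "act (\<lambda>f. bivar z * f)"
  show "additive ?D" "additive ?X"
    by (intro additive_act partial_deriv_mem weyl_algebra.mult)+
  show "?D (?X y) = ?X (?D y) + y" for y by (rule act_partial_deriv_bivar)
  show "l = 0 \<or> y = 0" if "(\<Sum>i<l. y) = 0" for l :: nat and y :: 'a
    using torsion_free[OF units that] .
  have D: "(?D ^^ j) x \<in> M (u + - int j * p, v + - int j * q)" for j
    using funpow_act_mem[OF deriv x, of j] by simp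
  from D[of "Suc b"] zero[of "- int (Suc b)"] show "(?D ^^ Suc b) x = 0" by simp
  fix j
  \<comment> \<open>The first \<open>j\<close> upward steps cancel the descent; \<open>Suc a\<close>
    more leave the support.\<close>
  have "(?X ^^ Suc (a + j)) ((?D ^^ j) x) \<in> M (u + int (Suc a) * p, v + int (Suc a) * q)"
    using funpow_act_mem[OF var D, of "Suc (a + j)" j] by (simp add: algebra_simps)
  moreover have "M (u + int (Suc a) * p, v + int (Suc a) * q) = {0}"
    by (rule zero) simp
  ultimately show "\<exists>l. (?X ^^ l) ((?D ^^ j) x) = 0" by blast
qed

lemma row_vanishes:
  assumes "\<And>l. l \<noteq> 0 \<Longrightarrow> (of_nat l :: 'c) dvd 1"
    and "\<And>u. u < - int b \<or> int a < u \<Longrightarrow> M (u, v) = {0}"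
  shows "M (u, v) = {0}"
proof -
  \<comment> \<open>Offsets are now counted from \<open>u\<close>; enlarging both bounds by its
    absolute value covers either sign.\<close>
  have zero: "M (u + k, v) = {0}"
    if "k < - int (b + nat \<bar>u\<bar>) \<or> int (a + nat \<bar>u\<bar>) < k" for k
    by (rule assms(2)) (use that in arith)
  have "x = 0" if "x \<in> M (u, v)" for x
    \<comment> \<open>Any variable of the first kind serves; \<open>undefined\<close> picks an
      arbitrary index.\<close>
    by (rule line_vanishes[OF assms(1), of "Inl undefined" 1 0 "b + nat \<bar>u\<bar>" "a + nat \<bar>u\<bar>" u v])
      (use that zero in \<open>auto intro: weyl_bihom.intros\<close>)
  then show ?thesis using zero_mem by blast
qed

lemma column_vanishes:
  assumes "\<And>l. l \<noteq> 0 \<Longrightarrow> (of_nat l :: 'c) dvd 1"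
    and "\<And>v. v < - int b \<or> int a < v \<Longrightarrow> M (u, v) = {0}"
  shows "M (u, v) = {0}"
proof -
  have zero: "M (u, v + k) = {0}"
    if "k < - int (b + nat \<bar>v\<bar>) \<or> int (a + nat \<bar>v\<bar>) < k" for k
    by (rule assms(2)) (use that in arith)
  have "x = 0" if "x \<in> M (u, v)" for x
    by (rule line_vanishes[OF assms(1), of "Inr undefined" 0 1 "b + nat \<bar>v\<bar>" "a + nat \<bar>v\<bar>" u v])
      (use that zero in \<open>auto intro: weyl_bihom.intros\<close>)
  then show ?thesis using zero_mem by blast
qed

end

text \<open>A subring contains all \<open>of_nat l\<close>, and a nonzero element of
  \<open>K\<close> has an inverse in \<open>K\<close>, hence in the whole ring.\<close>

lemma of_nat_dvd_one:
  assumes "subfield K (ring_of_type_algebra :: 'c::comm_ring_1 ring)"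
    and "CHAR('c) = 0" and "l \<noteq> 0"
  shows "(of_nat l :: 'c) dvd 1"
proof -
  let ?C = "ring_of_type_algebra :: 'c ring"
  interpret ring ?C by (rule ring_from_type_algebra)
  note K = subringE[OF subfieldE(1)[OF assms(1)]]
  have "(of_nat l :: 'c) \<in> K"
  proof (induction l)
    case 0
    show ?case using K(2) by (simp add: ring_of_type_algebra_def)
  next
    case (Suc l)
    then show ?case using K(7)[of 1 "of_nat l"] K(3) by (simp add: ring_of_type_algebra_def)
  qed
  moreover have "(of_nat l :: 'c) \<noteq> 0"
    using assms(2,3) by (simp add: of_nat_eq_0_iff_char_dvd)
  ultimately have "of_nat l \<in> K - {\<zero>\<^bsub>?C\<^esub>}" by (simp add: ring_of_type_algebra_def)
  from subfield_m_inv(2)[OF assms(1) this] show ?thesis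
    by (auto simp: ring_of_type_algebra_def intro: dvdI[OF sym])
qed

theorem theorem5p4:
  fixes K :: "'c::comm_ring_1 set"
    and act :: "('c, 'n::finite, 'm::finite) bipoly_op \<Rightarrow> 'a::ab_group_add \<Rightarrow> 'a"
    and M :: "int \<times> int \<Rightarrow> 'a set"
    and a1 a2 b1 b2 :: nat
    and S :: "(int \<times> int) set"
  assumes "noetherian_ring (ring_of_type_algebra :: 'c ring)"
    and "subfield K (ring_of_type_algebra :: 'c ring)"
    and "uncountable K"
    and "CHAR('c) = 0" \<comment> \<open>\<open>K\<close> and \<open>'c\<close> share the unit element, hence the characteristic\<close>
    and "generalized_eulerian_module act M"
    and "countably_generated_bigraded act M"
    and "S = {(u, v). - int b1 \<le> u \<and> u \<le> int a1 \<or> - int b2 \<le> v \<and> v \<le> int a2}"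
    and "\<And>u v. (u, v) \<notin> S \<Longrightarrow> M (u, v) = {0}"
  shows "(UNIV :: 'a set) = {0}"
proof -
  interpret generalized_eulerian_module act M by (rule assms(5))
  note units = of_nat_dvd_one[OF assms(2,4)]
  have outside: "M (u, v) = {0}" if "v < - int b2 \<or> int a2 < v" for u v
    by (rule row_vanishes[OF units, where b = b1 and a = a1], assumption, rule assms(8))
      (use that assms(7) in auto)
  have component: "M d = {0}" for d
  proof (cases d)
    case (Pair u v)
    \<comment> \<open>\<open>outside\<close> bounds the support of every column, so no case
      distinction on \<open>u\<close> is needed.\<close>
    show ?thesis unfolding Pair by (rule column_vanishes[OF units outside])
  qed
  have "x = 0" for x :: 'a
  proof -
    obtain g where "\<And>d. g d \<in> M d" and x: "x = (\<Sum>d\<in>{d. g d \<noteq> 0}. g d)"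
      using direct_sum[of x] by blast
    then have "g d = 0" for d using component by blast
    with x show ?thesis by simp
  qed
  then show ?thesis by auto
qed

end
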